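(* Let $\Omega$ be a connected weighted simplicial complex on $[n]$ with a free group action from the finite group $G$. Then every $p\in\mathcal P=\mathbb R[\mathbf x^{[0]},\dots,\mathbf x^{[n]}]$ (where $\mathbf x^{[i]}=(x^{[i]}_1,\dots,x^{[i]}_m)$ for each $i\in[n]$) which is a sum of squares and $G$-invariant has an sos $(\Omega,G)$-decomposition, i.e. $\operatorname{sos-rank}_{(\Omega,G)}(p)<\infty$.
   Context: $[n]=\{0,\dots,n\}$ and $\mathbb N=\{0,1,2,\dots\}$. A weighted simplicial complex on $[n]$ is a map $\Omega$ from the power set of $[n]$ to $\mathbb N$ such that $\Omega(S_1)$ divides $\Omega(S_2)$ whenever $S_1\subseteq S_2$; it is always assumed that $\Omega(\{i\})\neq 0$ for all $i\in[n]$. Sets $S$ with $\Omega(S)\ne0$ are called simplices, inclusion-maximal simplices are called facets, and $\mathcal F$ is the set of facets. $\widetilde{\mathcal F}$ is the multiset containing each facet $F$ exactly $\Omega(F)$ times (copies are regarded as distinct elements), $c:\widetilde{\mathcal F}\to\mathcal F$ maps each copy to its underlying facet, and $\widetilde{\mathcal F}_i=\{\mathfrak f\in\widetilde{\mathcal F}: i\in c(\mathfrak f)\}$. Two vertices are neighbours if some facet contains both; $\Omega$ is connected if any two vertices are joined by a chain of consecutive neighbours. An action of a finite group $G$ on $\Omega$ consists of an action of $G$ on $[n]$ with $\Omega(gS)=\Omega(S)$ for all $g\in G$, $S\subseteq[n]$, together with an action of $G$ on the set $\widetilde{\mathcal F}$ such that $c(g\mathfrak f)=g\,c(\mathfrak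 f)$. The action on $\Omega$ is called free if the action on $\widetilde{\mathcal F}$ is free (all stabilizers are trivial). If $f\in\mathbb R[\mathbf x^{[i]}]$, then $f(\mathbf x^{[j]})$ denotes the polynomial obtained by substituting $\mathbf x^{[j]}$ for $\mathbf x^{[i]}$. $G$ acts on $\mathcal P$ by $(gp)(\mathbf x^{[0]},\dots,\mathbf x^{[n]})=p(\mathbf x^{[g0]},\dots,\mathbf x^{[gn]})$, and $p$ is $G$-invariant if $gp=p$ for all $g\in G$. For sets $A,\mathcal I$, $\mathcal I^A$ denotes the set of functions $A\to\mathcal I$. For $\alpha\in\mathcal I^{\widetilde{\mathcal F}}$, $\alpha_{|_i}$ is its restriction to $\widetilde{\mathcal F}_i$. For $\beta\in\mathcal I^{\widetilde{\mathcal F}_i}$ and $g\in G$, ${}^g\beta\in\mathcal I^{\widetilde{\mathcal F}_{gi}}$ is defined by $({}^g\beta)(\mathfrak f)=\beta(g^{-1}\mathfrak f)$. Let $\mathfrak q=(q_{\mathbf k})_{\mathbf k\in\mathcal S}$ be a family in $\mathcal P$ indexed by $\mathcal S=\mathcal S_0\times\cdots\times\mathcal S_n$ with finite sets $\mathcal S_i$ satisfying $\mathcal S_i=\mathcal S_{gi}$ for all $g\in G$. An $(\Omega,G)$-decomposition of $\mathfrak q$ consists of a finite index set $\mathcal I$ and polynomials $q^{[i]}_{k,\beta}\in\mathbb R[\mathbf x^{[i]}]$ for $i\in[n]$, $k\in\mathcal S_i$, $\beta\in\mathcal I^{\widetilde{\mathcal F}_i}$ such that for every $\mathbf k=(k_0,\dots,k_n)\in\mathcal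 S$ $$q_{\mathbf k}=\sum_{\alpha\in\mathcal I^{\widetilde{\mathcal F}}}q^{[0]}_{k_0,\alpha_{|_0}}(\mathbf x^{[0]})\cdots q^{[n]}_{k_n,\alpha_{|_n}}(\mathbf x^{[n]}),$$ and $q^{[i]}_{k,\beta}(\mathbf x^{[i]})=q^{[gi]}_{k,{}^g\beta}(\mathbf x^{[i]})$ for all $i$, $k\in\mathcal S_i$, $\beta$, $g$. The $(\Omega,G)$-rank of $\mathfrak q$ is the smallest such $|\mathcal I|$. An sos $(\Omega,G)$-decomposition of $p$ is such a family $\mathfrak q$ with $p=\sum_{\mathbf k\in\mathcal S}q_{\mathbf k}^2$ together with an $(\Omega,G)$-decomposition of $\mathfrak q$; $\operatorname{sos-rank}_{(\Omega,G)}(p)$ is the minimal $(\Omega,G)$-rank among all such families ($\infty$ if there is none). *)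

theory Defs
  imports "HOL-Library.Poly_Mapping" "HOL-Library.FuncSet" "HOL-Library.Extended_Nat"
    "HOL-Algebra.Group_Action" Complex_Main
begin

text \<open>The variable \<open>(i, j)\<close> is the \<open>j\<close>-th variable of the \<open>i\<close>-th block. Polynomials are finitely
  supported coefficient functions on monomials, with the convolution product of
  \<open>HOL-Library.Poly_Mapping\<close>.\<close>

type_synonym mpol = "((nat \<times> nat) \<Rightarrow>\<^sub>0 nat) \<Rightarrow>\<^sub>0 real"

definition var :: "nat \<times> nat \<Rightarrow> mpol" where
  "var v = Poly_Mapping.single (Poly_Mapping.single v 1) 1"

definition const :: "real \<Rightarrow> mpol" where
  "const c = Poly_Mapping.single 0 c"

definition vars :: "mpol \<Rightarrow> (nat \<times> nat) set" where
  "vars p = (\<Union>t\<in>Poly_Mapping.keys p. Poly_Mapping.keys t)"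

definition subst :: "(nat \<times> nat \<Rightarrow> mpol) \<Rightarrow> mpol \<Rightarrow> mpol" where
  "subst f p = (\<Sum>t\<in>Poly_Mapping.keys p. const (Poly_Mapping.lookup p t) *
     (\<Prod>v\<in>Poly_Mapping.keys t. f v ^ Poly_Mapping.lookup t v))"

definition polys :: "nat \<Rightarrow> nat \<Rightarrow> mpol set" where
  "polys n m = {p. vars p \<subseteq> {0..n} \<times> {1..m}}"

definition block_polys :: "nat \<Rightarrow> nat \<Rightarrow> mpol set" where
  "block_polys m i = {p. vars p \<subseteq> {i} \<times> {1..m}}"

text \<open>For \<open>f\<close> in the variables of a single block, \<open>to_block j f\<close> is \<open>f\<close> evaluated at the variables
  of block \<open>j\<close>.\<close>

definition to_block :: "nat \<Rightarrow> mpol \<Rightarrow> mpol" where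
  "to_block j f = subst (\<lambda>(i, l). var (j, l)) f"

definition permute_blocks :: "(nat \<Rightarrow> nat) \<Rightarrow> mpol \<Rightarrow> mpol" where
  "permute_blocks \<sigma> p = subst (\<lambda>(i, l). var (\<sigma> i, l)) p"

definition is_sos :: "nat \<Rightarrow> nat \<Rightarrow> mpol \<Rightarrow> bool" where
  "is_sos n m p \<longleftrightarrow> (\<exists>ps. set ps \<subseteq> polys n m \<and> p = sum_list (map (\<lambda>q. q ^ 2) ps))"

definition invariant_poly :: "('g, 'b) monoid_scheme \<Rightarrow> ('g \<Rightarrow> nat \<Rightarrow> nat) \<Rightarrow> mpol \<Rightarrow> bool" where
  "invariant_poly G \<phi> p \<longleftrightarrow> (\<forall>g\<in>carrier G. permute_blocks (\<phi> g) p = p)"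

text \<open>Only the values of \<open>\<Omega>\<close> on subsets of \<open>{0..n}\<close> matter.\<close>

definition weighted_complex :: "nat \<Rightarrow> (nat set \<Rightarrow> nat) \<Rightarrow> bool" where
  "weighted_complex n \<Omega> \<longleftrightarrow>
     (\<forall>S1 S2. S1 \<subseteq> S2 \<longrightarrow> S2 \<subseteq> {0..n} \<longrightarrow> \<Omega> S1 dvd \<Omega> S2) \<and> (\<forall>i\<in>{0..n}. \<Omega> {i} \<noteq> 0)"

definition simplices :: "nat \<Rightarrow> (nat set \<Rightarrow> nat) \<Rightarrow> nat set set" where
  "simplices n \<Omega> = {S. S \<subseteq> {0..n} \<and> \<Omega> S \<noteq> 0}"

definition facets :: "nat \<Rightarrow> (nat set \<Rightarrow> nat) \<Rightarrow> nat set set" where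
  "facets n \<Omega> = {F \<in> simplices n \<Omega>. \<forall>S\<in>simplices n \<Omega>. F \<subseteq> S \<longrightarrow> S = F}"

text \<open>The multiset of facets, with distinguishable copies: \<open>(F, r)\<close> is the copy of \<open>F\<close> numbered
  \<open>r < \<Omega> F\<close>, so the map to the underlying facet is \<open>fst\<close>.\<close>

definition mfacets :: "nat \<Rightarrow> (nat set \<Rightarrow> nat) \<Rightarrow> (nat set \<times> nat) set" where
  "mfacets n \<Omega> = (SIGMA F:facets n \<Omega>. {..<\<Omega> F})"

definition mfacets_at :: "nat \<Rightarrow> (nat set \<Rightarrow> nat) \<Rightarrow> nat \<Rightarrow> (nat set \<times> nat) set" where
  "mfacets_at n \<Omega> i = {f \<in> mfacets n \<Omega>. i \<in> fst f}"

definition neighbours :: "nat \<Rightarrow> (nat set \<Rightarrow> nat) \<Rightarrow> (nat \<times> nat) set" where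
  "neighbours n \<Omega> = {(i, j). \<exists>F\<in>facets n \<Omega>. i \<in> F \<and> j \<in> F}"

definition connected_complex :: "nat \<Rightarrow> (nat set \<Rightarrow> nat) \<Rightarrow> bool" where
  "connected_complex n \<Omega> \<longleftrightarrow> (\<forall>i\<in>{0..n}. \<forall>j\<in>{0..n}. (i, j) \<in> (neighbours n \<Omega>)\<^sup>*)"

text \<open>\<open>\<phi>\<close> is the action on the vertices and \<open>\<psi>\<close> the action on the copies of facets.\<close>

definition complex_action :: "nat \<Rightarrow> (nat set \<Rightarrow> nat) \<Rightarrow> ('g, 'b) monoid_scheme \<Rightarrow>
    ('g \<Rightarrow> nat \<Rightarrow> nat) \<Rightarrow> ('g \<Rightarrow> nat set \<times> nat \<Rightarrow> nat set \<times> nat) \<Rightarrow> bool" where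
  "complex_action n \<Omega> G \<phi> \<psi> \<longleftrightarrow>
     finite (carrier G) \<and>
     group_action G {0..n} \<phi> \<and>
     (\<forall>g\<in>carrier G. \<forall>S. S \<subseteq> {0..n} \<longrightarrow> \<Omega> (\<phi> g ` S) = \<Omega> S) \<and>
     group_action G (mfacets n \<Omega>) \<psi> \<and>
     (\<forall>g\<in>carrier G. \<forall>f\<in>mfacets n \<Omega>. fst (\<psi> g f) = \<phi> g ` fst f)"

definition free_complex_action :: "nat \<Rightarrow> (nat set \<Rightarrow> nat) \<Rightarrow> ('g, 'b) monoid_scheme \<Rightarrow>
    ('g \<Rightarrow> nat \<Rightarrow> nat) \<Rightarrow> ('g \<Rightarrow> nat set \<times> nat \<Rightarrow> nat set \<times> nat) \<Rightarrow> bool" where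
  "free_complex_action n \<Omega> G \<phi> \<psi> \<longleftrightarrow>
     complex_action n \<Omega> G \<phi> \<psi> \<and>
     (\<forall>f\<in>mfacets n \<Omega>. stabilizer G \<psi> f = {\<one>\<^bsub>G\<^esub>})"

definition translate :: "nat \<Rightarrow> (nat set \<Rightarrow> nat) \<Rightarrow> ('g, 'b) monoid_scheme \<Rightarrow>
    ('g \<Rightarrow> nat \<Rightarrow> nat) \<Rightarrow> ('g \<Rightarrow> nat set \<times> nat \<Rightarrow> nat set \<times> nat) \<Rightarrow>
    'g \<Rightarrow> nat \<Rightarrow> (nat set \<times> nat \<Rightarrow> 'i) \<Rightarrow> (nat set \<times> nat \<Rightarrow> 'i)" where
  "translate n \<Omega> G \<phi> \<psi> g i \<beta> = (\<lambda>f\<in>mfacets_at n \<Omega> (\<phi> g i). \<beta> (\<psi> (inv\<^bsub>G\<^esub> g) f))"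

definition index_family :: "nat \<Rightarrow> ('g, 'b) monoid_scheme \<Rightarrow> ('g \<Rightarrow> nat \<Rightarrow> nat) \<Rightarrow>
    (nat \<Rightarrow> 'k set) \<Rightarrow> bool" where
  "index_family n G \<phi> S \<longleftrightarrow>
     (\<forall>i\<in>{0..n}. finite (S i)) \<and> (\<forall>g\<in>carrier G. \<forall>i\<in>{0..n}. S i = S (\<phi> g i))"

definition og_decomposition :: "nat \<Rightarrow> nat \<Rightarrow> (nat set \<Rightarrow> nat) \<Rightarrow> ('g, 'b) monoid_scheme \<Rightarrow>
    ('g \<Rightarrow> nat \<Rightarrow> nat) \<Rightarrow> ('g \<Rightarrow> nat set \<times> nat \<Rightarrow> nat set \<times> nat) \<Rightarrow>
    (nat \<Rightarrow> 'k set) \<Rightarrow> ((nat \<Rightarrow> 'k) \<Rightarrow> mpol) \<Rightarrow>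
    'i set \<Rightarrow> (nat \<Rightarrow> 'k \<Rightarrow> (nat set \<times> nat \<Rightarrow> 'i) \<Rightarrow> mpol) \<Rightarrow> bool" where
  "og_decomposition n m \<Omega> G \<phi> \<psi> S q I Q \<longleftrightarrow>
     finite I \<and>
     (\<forall>i\<in>{0..n}. \<forall>k\<in>S i. \<forall>\<beta>\<in>mfacets_at n \<Omega> i \<rightarrow>\<^sub>E I. Q i k \<beta> \<in> block_polys m i) \<and>
     (\<forall>k\<in>PiE {0..n} S.
        q k = (\<Sum>\<alpha>\<in>mfacets n \<Omega> \<rightarrow>\<^sub>E I. \<Prod>i\<in>{0..n}. Q i (k i) (restrict \<alpha> (mfacets_at n \<Omega> i)))) \<and>
     (\<forall>i\<in>{0..n}. \<forall>k\<in>S i. \<forall>\<beta>\<in>mfacets_at n \<Omega> i \<rightarrow>\<^sub>E I. \<forall>g\<in>carrier G.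
        Q i k \<beta> = to_block i (Q (\<phi> g i) k (translate n \<Omega> G \<phi> \<psi> g i \<beta>)))"

text \<open>Since only the cardinalities of the index sets matter, the ranks range over index sets of
  natural numbers. The infimum of the empty set is \<open>\<infinity>\<close>.\<close>

definition og_rank :: "nat \<Rightarrow> nat \<Rightarrow> (nat set \<Rightarrow> nat) \<Rightarrow> ('g, 'b) monoid_scheme \<Rightarrow>
    ('g \<Rightarrow> nat \<Rightarrow> nat) \<Rightarrow> ('g \<Rightarrow> nat set \<times> nat \<Rightarrow> nat set \<times> nat) \<Rightarrow>
    (nat \<Rightarrow> 'k set) \<Rightarrow> ((nat \<Rightarrow> 'k) \<Rightarrow> mpol) \<Rightarrow> enat" where
  "og_rank n m \<Omega> G \<phi> \<psi> S q =
     Inf {enat (card I) | (I :: nat set) Q. og_decomposition n m \<Omega> G \<phi> \<psi> S q I Q}"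

definition sos_family :: "nat \<Rightarrow> nat \<Rightarrow> ('g, 'b) monoid_scheme \<Rightarrow> ('g \<Rightarrow> nat \<Rightarrow> nat) \<Rightarrow>
    mpol \<Rightarrow> (nat \<Rightarrow> 'k set) \<Rightarrow> ((nat \<Rightarrow> 'k) \<Rightarrow> mpol) \<Rightarrow> bool" where
  "sos_family n m G \<phi> p S q \<longleftrightarrow>
     index_family n G \<phi> S \<and>
     (\<forall>k\<in>PiE {0..n} S. q k \<in> polys n m) \<and>
     p = (\<Sum>k\<in>PiE {0..n} S. (q k) ^ 2)"

definition sos_og_decomposition :: "nat \<Rightarrow> nat \<Rightarrow> (nat set \<Rightarrow> nat) \<Rightarrow> ('g, 'b) monoid_scheme \<Rightarrow>
    ('g \<Rightarrow> nat \<Rightarrow> nat) \<Rightarrow> ('g \<Rightarrow> nat set \<times> nat \<Rightarrow> nat set \<times> nat) \<Rightarrow> mpol \<Rightarrow>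
    (nat \<Rightarrow> 'k set) \<Rightarrow> ((nat \<Rightarrow> 'k) \<Rightarrow> mpol) \<Rightarrow>
    'i set \<Rightarrow> (nat \<Rightarrow> 'k \<Rightarrow> (nat set \<times> nat \<Rightarrow> 'i) \<Rightarrow> mpol) \<Rightarrow> bool" where
  "sos_og_decomposition n m \<Omega> G \<phi> \<psi> p S q I Q \<longleftrightarrow>
     sos_family n m G \<phi> p S q \<and> og_decomposition n m \<Omega> G \<phi> \<psi> S q I Q"

definition sos_og_rank :: "nat \<Rightarrow> nat \<Rightarrow> (nat set \<Rightarrow> nat) \<Rightarrow> ('g, 'b) monoid_scheme \<Rightarrow>
    ('g \<Rightarrow> nat \<Rightarrow> nat) \<Rightarrow> ('g \<Rightarrow> nat set \<times> nat \<Rightarrow> nat set \<times> nat) \<Rightarrow> mpol \<Rightarrow> enat" where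
  "sos_og_rank n m \<Omega> G \<phi> \<psi> p =
     Inf {og_rank n m \<Omega> G \<phi> \<psi> S q | (S :: nat \<Rightarrow> nat set) q. sos_family n m G \<phi> p S q}"

end

theory Submission
  imports Defs
begin

text \<open>Write \<open>p = \<Sum>j. p\<^sub>j\<^sup>2\<close>. The squared polynomials are indexed by \<open>(j, g)\<close>: the index tuple with
  components \<open>k\<^sub>i = (j, g i)\<close> carries a multiple of \<open>g\<^sup>-\<^sup>1 p\<^sub>j\<close>, and all other tuples carry \<open>0\<close>.
  It depends on \<open>g\<close> only modulo the kernel \<open>K\<close> of the vertex action, so by invariance of \<open>p\<close> the
  squares add up to \<open>p\<close> once the \<open>p\<^sub>j\<close> are scaled by \<open>1 / sqrt (|K| |G|)\<close>.

  Freeness yields an equivariant map \<open>z\<close> from the copies of facets to \<open>G\<close>. For a monomial \<open>t\<close> of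
  \<open>p\<^sub>j\<close> and \<open>g \<in> G\<close>, label the copy \<open>f\<close> with \<open>((j, t), g z(f))\<close>. A local polynomial at \<open>i\<close> is nonzero
  only if the labels around \<open>i\<close> have this form for a common \<open>(j, t, g)\<close> with \<open>k\<^sub>i = (j, g i)\<close>; it is
  then the factor of \<open>t\<close> in block \<open>g i\<close>, moved to block \<open>i\<close>. By connectedness only globally
  consistent labellings contribute to the sum, and by equivariance of \<open>z\<close> the local polynomials
  are invariant.\<close>

subsection \<open>Substitution and variables\<close>

lemma const_0 [simp]: "const 0 = 0" and const_1 [simp]: "const 1 = 1"
  by (simp_all add: const_def)

lemma const_add: "const (a + b) = const a + const b"
  by (simp add: const_def single_add)

lemma const_mult: "const (a * b) = const a * const b"
  by (simp add: const_def mult_single)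

definition monom_eval :: "(nat \<times> nat \<Rightarrow> mpol) \<Rightarrow> (nat \<times> nat \<Rightarrow>\<^sub>0 nat) \<Rightarrow> mpol" where
  "monom_eval f t = (\<Prod>v\<in>Poly_Mapping.keys t. f v ^ Poly_Mapping.lookup t v)"

text \<open>Variables outside \<open>t\<close> have exponent 0 and contribute the factor 1. The
  freedom in \<open>A\<close> lets two monomials be multiplied over one common finite set;
  \<open>subst_superset\<close> serves the addition of polynomials in the same way.\<close>

lemma monom_eval_superset:
  assumes "finite A" "Poly_Mapping.keys t \<subseteq> A"
  shows "monom_eval f t = (\<Prod>v\<in>A. f v ^ Poly_Mapping.lookup t v)"
  unfolding monom_eval_def
  by (rule prod.mono_neutral_left) (use assms in \<open>auto simp: in_keys_iff\<close>)

lemma monom_eval_0 [simp]: "monom_eval f 0 = 1"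
  by (simp add: monom_eval_def)

lemma monom_eval_add: "monom_eval f (s + t) = monom_eval f s * monom_eval f t"
proof -
  let ?A = "Poly_Mapping.keys s \<union> Poly_Mapping.keys t"
  have "monom_eval f (s + t) = (\<Prod>v\<in>?A. f v ^ Poly_Mapping.lookup (s + t) v)"
    by (rule monom_eval_superset) (use keys_add[of s t] in auto)
  also have "\<dots> = (\<Prod>v\<in>?A. f v ^ Poly_Mapping.lookup s v) * (\<Prod>v\<in>?A. f v ^ Poly_Mapping.lookup t v)"
    by (simp add: lookup_add power_add prod.distrib)
  finally show ?thesis
    by (simp add: monom_eval_superset[of ?A])
qed

lemma subst_superset:
  assumes "finite A" "Poly_Mapping.keys p \<subseteq> A"
  shows "subst f p = (\<Sum>t\<in>A. const (Poly_Mapping.lookup p t) * monom_eval f t)"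
  unfolding subst_def monom_eval_def[symmetric]
  by (rule sum.mono_neutral_left) (use assms in \<open>auto simp: in_keys_iff\<close>)

lemma subst_0 [simp]: "subst f 0 = 0"
  by (simp add: subst_def)

lemma subst_single: "subst f (Poly_Mapping.single t c) = const c * monom_eval f t"
  by (subst subst_superset[of "{t}"]) auto

lemma subst_const [simp]: "subst f (const c) = const c"
  by (subst const_def) (simp add: subst_single)

lemma subst_1 [simp]: "subst f 1 = 1"
  using subst_const[of f 1] by simp

lemma subst_var [simp]: "subst f (var v) = f v"
  by (simp add: var_def subst_single monom_eval_def)

lemma subst_add: "subst f (p + q) = subst f p + subst f q"
proof -
  let ?A = "Poly_Mapping.keys p \<union> Poly_Mapping.keys q"
  have "subst f (p + q) = (\<Sum>t\<in>?A. const (Poly_Mapping.lookup (p + q) t) * monom_eval f t)"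
    by (rule subst_superset) (use keys_add[of p q] in auto)
  also have "\<dots> = (\<Sum>t\<in>?A. const (Poly_Mapping.lookup p t) * monom_eval f t)
      + (\<Sum>t\<in>?A. const (Poly_Mapping.lookup q t) * monom_eval f t)"
    by (simp add: lookup_add const_add distrib_right sum.distrib)
  finally show ?thesis
    by (simp add: subst_superset[of ?A])
qed

lemma subst_sum: "subst f (\<Sum>i\<in>A. p i) = (\<Sum>i\<in>A. subst f (p i))"
  by (induction A rule: infinite_finite_induct) (simp_all add: subst_add)

lemma poly_mapping_eq_sum_single:
  "p = (\<Sum>t\<in>Poly_Mapping.keys p. Poly_Mapping.single t (Poly_Mapping.lookup p t))"
  by (rule poly_mapping_eqI)
     (auto simp: lookup_sum lookup_single when_def sum.delta in_keys_iff)

text \<open>Both factors are expanded into single terms, so bilinearity leaves only the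
  multiplicativity of \<open>monom_eval\<close> on sums of exponents.\<close>

lemma subst_mult: "subst f (p * q) = subst f p * subst f q"
proof -
  let ?s = "\<lambda>p t. Poly_Mapping.single t (Poly_Mapping.lookup p t)"
  have "subst f (p * q) = subst f ((\<Sum>s\<in>Poly_Mapping.keys p. ?s p s) * (\<Sum>t\<in>Poly_Mapping.keys q. ?s q t))"
    using poly_mapping_eq_sum_single[of p] poly_mapping_eq_sum_single[of q] by simp
  also have "\<dots> = (\<Sum>s\<in>Poly_Mapping.keys p. \<Sum>t\<in>Poly_Mapping.keys q. subst f (?s p s) * subst f (?s q t))"
    by (simp add: sum_product subst_sum mult_single subst_single monom_eval_add const_mult mult_ac)
  also have "\<dots> = subst f (\<Sum>s\<in>Poly_Mapping.keys p. ?s p s) * subst f (\<Sum>t\<in>Poly_Mapping.keys q. ?s q t)"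
    by (simp add: sum_product subst_sum)
  finally show ?thesis
    using poly_mapping_eq_sum_single[of p] poly_mapping_eq_sum_single[of q] by simp
qed

lemma subst_power: "subst f (p ^ k) = subst f p ^ k"
  by (induction k) (simp_all add: subst_mult)

lemma subst_prod: "subst f (\<Prod>i\<in>A. p i) = (\<Prod>i\<in>A. subst f (p i))"
  by (induction A rule: infinite_finite_induct) (simp_all add: subst_mult)

lemma subst_monom_eval: "subst f (monom_eval g t) = monom_eval (\<lambda>v. subst f (g v)) t"
  by (simp add: monom_eval_def subst_prod subst_power)

lemma subst_subst: "subst f (subst g p) = subst (\<lambda>v. subst f (g v)) p"
proof -
  have "subst f (subst g p) = (\<Sum>t\<in>Poly_Mapping.keys p. const (Poly_Mapping.lookup p t) * subst f (monom_eval g t))"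
    by (simp add: subst_superset[OF finite_keys order_refl, of g p] subst_sum subst_mult)
  then show ?thesis
    by (simp add: subst_monom_eval subst_superset[OF finite_keys order_refl, of _ p])
qed

lemma monom_eval_var: "monom_eval var t = Poly_Mapping.single t 1"
proof -
  have single_power: "var v ^ k = Poly_Mapping.single (Poly_Mapping.single v k) 1" for v k
    by (induction k) (simp_all add: var_def mult_single flip: single_add)
  have prod: "(\<Prod>v\<in>A. Poly_Mapping.single (h v) 1 :: mpol) = Poly_Mapping.single (\<Sum>v\<in>A. h v) 1"
    for A and h :: "nat \<times> nat \<Rightarrow> (nat \<times> nat \<Rightarrow>\<^sub>0 nat)"
    by (induction A rule: infinite_finite_induct) (simp_all add: mult_single)
  show ?thesis
    by (simp add: monom_eval_def single_power prod flip: poly_mapping_eq_sum_single)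
qed

lemma subst_id: "subst var p = p"
proof -
  have "subst var p = (\<Sum>t\<in>Poly_Mapping.keys p. Poly_Mapping.single t (Poly_Mapping.lookup p t))"
    by (simp add: subst_superset[OF finite_keys order_refl] monom_eval_var const_def mult_single)
  then show ?thesis
    by (simp flip: poly_mapping_eq_sum_single)
qed

lemma subst_cong:
  assumes "\<And>v. v \<in> vars p \<Longrightarrow> f v = g v"
  shows "subst f p = subst g p"
proof -
  have "f v = g v" if "t \<in> Poly_Mapping.keys p" "v \<in> Poly_Mapping.keys t" for t v
    using assms[of v] that unfolding vars_def by blast
  then show ?thesis
    by (simp add: subst_def)
qed

section \<open>Variables of sums, products and substitutions\<close>

lemma vars_const [simp]: "vars (const c) = {}"
  by (auto simp: vars_def const_def split: if_splits)

lemma vars_0 [simp]: "vars 0 = {}"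
  by (simp add: vars_def)

lemma vars_1 [simp]: "vars 1 = {}"
  by (simp add: vars_def)

lemma vars_var [simp]: "vars (var v) = {v}"
  by (simp add: vars_def var_def)

lemma vars_add: "vars (p + q) \<subseteq> vars p \<union> vars q"
  using keys_add[of p q] by (fastforce simp: vars_def)

lemma vars_mult: "vars (p * q) \<subseteq> vars p \<union> vars q"
proof
  fix v assume "v \<in> vars (p * q)"
  then obtain t where "t \<in> Poly_Mapping.keys (p * q)" "v \<in> Poly_Mapping.keys t"
    by (auto simp: vars_def)
  moreover from this obtain a b where "t = a + b" "a \<in> Poly_Mapping.keys p" "b \<in> Poly_Mapping.keys q"
    using keys_mult by blast
  ultimately show "v \<in> vars p \<union> vars q"
    using keys_add[of a b] by (auto simp: vars_def)
qed

lemma vars_sum: "vars (\<Sum>i\<in>A. p i) \<subseteq> (\<Union>i\<in>A. vars (p i))"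
  by (induction A rule: infinite_finite_induct) (use vars_add in force)+

lemma vars_prod: "vars (\<Prod>i\<in>A. p i) \<subseteq> (\<Union>i\<in>A. vars (p i))"
  by (induction A rule: infinite_finite_induct) (use vars_mult in force)+

lemma vars_power: "vars (p ^ k) \<subseteq> vars p"
  by (induction k) (use vars_mult in force)+

lemma vars_monom_eval: "vars (monom_eval f t) \<subseteq> (\<Union>v\<in>Poly_Mapping.keys t. vars (f v))"
  unfolding monom_eval_def using vars_prod vars_power by fastforce

lemma vars_subst: "vars (subst f p) \<subseteq> (\<Union>v\<in>vars p. vars (f v))"
proof
  fix w assume "w \<in> vars (subst f p)"
  then obtain t where "t \<in> Poly_Mapping.keys p"
      "w \<in> vars (const (Poly_Mapping.lookup p t) * monom_eval f t)"
    unfolding subst_superset[OF finite_keys order_refl] using vars_sum by blast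
  then show "w \<in> (\<Union>v\<in>vars p. vars (f v))"
    using vars_mult vars_monom_eval[of f t] by (fastforce simp: vars_def[of p])
qed

subsection \<open>Free actions on connected complexes\<close>

text \<open>Fix a representative in every orbit and let \<open>z x\<close> be the group element
  carrying it to \<open>x\<close>. Freeness makes this element unique, and
  \<open>g \<otimes> z x\<close> carries the same representative to
  \<open>\<phi> g x\<close>.\<close>

lemma (in group_action) equivariant_map_exists:
  assumes "\<And>x. x \<in> E \<Longrightarrow> stabilizer G \<phi> x = {\<one>}"
  shows "\<exists>z. z \<in> E \<rightarrow> carrier G \<and> (\<forall>g\<in>carrier G. \<forall>x\<in>E. z (\<phi> g x) = g \<otimes> z x)"
proof -
  interpret group G
    using group_hom by (rule group_hom.axioms(1))
  define rep where "rep x = (SOME y. y \<in> orbit G \<phi> x)" for x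
  define z where "z x = (SOME g. g \<in> carrier G \<and> \<phi> g (rep x) = x)" for x
  have rep: "rep x \<in> E" "\<exists>g\<in>carrier G. \<phi> g (rep x) = x" if "x \<in> E" for x
  proof -
    have "rep x \<in> orbit G \<phi> x"
      unfolding rep_def using orbit_refl[OF that] by (rule someI)
    moreover from this show "rep x \<in> E"
      using that element_image by (auto simp: orbit_def)
    ultimately have "x \<in> orbit G \<phi> (rep x)"
      using orbit_sym that by blast
    then obtain g where "g \<in> carrier G" "x = \<phi> g (rep x)"
      by (auto simp: orbit_def)
    then show "\<exists>g\<in>carrier G. \<phi> g (rep x) = x"
      by (intro bexI[of _ g]) (rule sym)
  qed
  have z: "z x \<in> carrier G" "\<phi> (z x) (rep x) = x" if "x \<in> E" for x
    using someI_ex[of "\<lambda>g. g \<in> carrier G \<and> \<phi> g (rep x) = x"] rep(2)[OF that]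
    by (auto simp: z_def)
  have free: "g = h" if "x \<in> E" "g \<in> carrier G" "h \<in> carrier G" "\<phi> g x = \<phi> h x" for x g h
  proof -
    have "\<phi> (inv h \<otimes> g) x = x"
      using that by (simp add: composition_rule orbit_sym_aux)
    then have "inv h \<otimes> g \<in> stabilizer G \<phi> x"
      using that by (simp add: stabilizer_def)
    then show ?thesis
      using assms that by (metis inv_closed inv_equality inv_inv singletonD)
  qed
  \<comment> \<open>\<open>rep\<close> is chosen from the orbit as a set, so equality of the two
    orbits gives literally the same representative.\<close>
  have rep_action: "rep (\<phi> g x) = rep x" if "g \<in> carrier G" "x \<in> E" for g x
  proof -
    have "orbit G \<phi> (\<phi> g x) = orbit G \<phi> x"
    proof (intro equalityI subsetI)
      fix y assume "y \<in> orbit G \<phi> (\<phi> g x)"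
      then obtain h where "h \<in> carrier G" "y = \<phi> h (\<phi> g x)"
        by (auto simp: orbit_def)
      then have "y = \<phi> (h \<otimes> g) x" "h \<otimes> g \<in> carrier G"
        using that by (simp_all add: composition_rule)
      then show "y \<in> orbit G \<phi> x"
        by (auto simp: orbit_def)
    next
      fix y assume "y \<in> orbit G \<phi> x"
      then obtain h where h: "h \<in> carrier G" "y = \<phi> h x"
        by (auto simp: orbit_def)
      have "\<phi> (h \<otimes> inv g) (\<phi> g x) = \<phi> (h \<otimes> inv g \<otimes> g) x"
        using that h by (intro composition_rule[symmetric]) auto
      also have "\<dots> = y"
        using that h by (simp add: m_assoc)
      finally show "y \<in> orbit G \<phi> (\<phi> g x)"
        using that h by (auto simp: orbit_def intro!: exI[of _ "h \<otimes> inv g"])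
    qed
    then show ?thesis
      by (simp add: rep_def)
  qed
  have "z (\<phi> g x) = g \<otimes> z x" if "g \<in> carrier G" "x \<in> E" for g x
  proof (rule free[of "rep x"])
    have gx: "\<phi> g x \<in> E"
      using that element_image by blast
    show "\<phi> (z (\<phi> g x)) (rep x) = \<phi> (g \<otimes> z x) (rep x)"
      using z(2)[OF gx] z[OF that(2)] rep(1) rep_action that by (simp add: composition_rule)
    show "z (\<phi> g x) \<in> carrier G" "g \<otimes> z x \<in> carrier G" "rep x \<in> E"
      using z(1) gx rep(1) that by auto
  qed
  then show ?thesis
    using z(1) by auto
qed

locale free_connected_action =
  fixes n :: nat and \<Omega> :: "nat set \<Rightarrow> nat" and G (structure) and \<phi> \<psi>
  assumes weighted: "weighted_complex n \<Omega>"
    and connected: "connected_complex n \<Omega>"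
    and free: "free_complex_action n \<Omega> G \<phi> \<psi>"
begin

sublocale vertex: group_action G "{0..n}" \<phi>
  using free by (simp add: free_complex_action_def complex_action_def)

sublocale facet: group_action G "mfacets n \<Omega>" \<psi>
  using free by (simp add: free_complex_action_def complex_action_def)

sublocale group G
  using vertex.group_hom by (rule group_hom.axioms(1))

lemma finite_G: "finite (carrier G)"
  using free by (simp add: free_complex_action_def complex_action_def)

lemma fst_facet_action:
  "g \<in> carrier G \<Longrightarrow> f \<in> mfacets n \<Omega> \<Longrightarrow> fst (\<psi> g f) = \<phi> g ` fst f"
  using free by (simp add: free_complex_action_def complex_action_def)

lemma vertex_closed: "g \<in> carrier G \<Longrightarrow> i \<le> n \<Longrightarrow> \<phi> g i \<le> n"
  using vertex.element_image[of g i] by simp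

lemma vertex_mult:
  "g \<in> carrier G \<Longrightarrow> h \<in> carrier G \<Longrightarrow> i \<le> n \<Longrightarrow> \<phi> (g \<otimes> h) i = \<phi> g (\<phi> h i)"
  by (simp add: vertex.composition_rule)

lemma vertex_inv: "g \<in> carrier G \<Longrightarrow> i \<le> n \<Longrightarrow> \<phi> (inv g) (\<phi> g i) = i"
  by (rule vertex.orbit_sym_aux) auto

section \<open>Copies of facets and their vertices\<close>

lemma finite_mfacets: "finite (mfacets n \<Omega>)"
proof -
  have "facets n \<Omega> \<subseteq> Pow {0..n}"
    by (auto simp: facets_def simplices_def)
  then have "finite (facets n \<Omega>)"
    by (rule finite_subset) simp
  then show ?thesis
    by (simp add: mfacets_def)
qed

lemma mfacets_at_subset: "mfacets_at n \<Omega> i \<subseteq> mfacets n \<Omega>"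
  by (auto simp: mfacets_at_def)

text \<open>Copy number 0 exists because a facet is a simplex and so has nonzero weight.\<close>

lemma facet_copy: "F \<in> facets n \<Omega> \<Longrightarrow> i \<in> F \<Longrightarrow> (F, 0) \<in> mfacets_at n \<Omega> i"
  by (auto simp: mfacets_at_def mfacets_def facets_def simplices_def)

text \<open>The singleton \<open>{i}\<close> has nonzero weight, and among the finitely many
  simplices a maximal one lies above it.\<close>

lemma mfacets_at_nonempty:
  assumes "i \<le> n"
  shows "mfacets_at n \<Omega> i \<noteq> {}"
proof -
  have "{i} \<in> simplices n \<Omega>"
    using weighted assms by (auto simp: weighted_complex_def simplices_def)
  moreover have "finite (simplices n \<Omega>)"
    by (rule finite_subset[of _ "Pow {0..n}"]) (auto simp: simplices_def)
  ultimately obtain F where "F \<in> simplices n \<Omega>" "{i} \<subseteq> F"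
      "\<forall>S\<in>simplices n \<Omega>. F \<subseteq> S \<longrightarrow> F = S"
    using finite_has_maximal2[of "simplices n \<Omega>" "{i}"] by blast
  then have "F \<in> facets n \<Omega>" "i \<in> F"
    by (auto simp: facets_def)
  then show ?thesis
    using facet_copy by blast
qed

text \<open>Since \<open>{0}\<close> is a simplex, the empty set is never maximal. Hence conditions
  imposed around the vertices reach every copy.\<close>

lemma mfacet_has_vertex:
  assumes "f \<in> mfacets n \<Omega>"
  obtains i where "i \<le> n" "f \<in> mfacets_at n \<Omega> i"
proof -
  have "fst f \<in> facets n \<Omega>"
    using assms by (auto simp: mfacets_def)
  then have F: "fst f \<subseteq> {0..n}" "\<forall>S\<in>simplices n \<Omega>. fst f \<subseteq> S \<longrightarrow> S = fst f"
    unfolding facets_def by (simp_all add: simplices_def)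
  have "{0} \<in> simplices n \<Omega>"
    using weighted by (auto simp: weighted_complex_def simplices_def)
  with F(2) have "fst f \<noteq> {}"
    by blast
  then obtain i where "i \<in> fst f"
    by blast
  then show ?thesis
    using that[of i] F(1) assms by (auto simp: mfacets_at_def)
qed

lemma facet_action_mfacets_at:
  assumes "g \<in> carrier G" "f \<in> mfacets_at n \<Omega> i"
  shows "\<psi> g f \<in> mfacets_at n \<Omega> (\<phi> g i)"
  using assms facet.element_image[of g f] by (auto simp: mfacets_at_def fst_facet_action)

text \<open>\<open>\<psi> g\<close> maps the copies around \<open>i\<close> bijectively onto those
  around \<open>\<phi> g i\<close>. The predicate sees a copy together with its image, so that a
  condition on translated labels can be pulled back in
  \<open>local_poly_equivariant\<close>.\<close>

lemma ball_translated_mfacets_at: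
  assumes "g \<in> carrier G" "i \<le> n"
  shows "(\<forall>f\<in>mfacets_at n \<Omega> (\<phi> g i). P (\<psi> (inv g) f) f) \<longleftrightarrow> (\<forall>f\<in>mfacets_at n \<Omega> i. P f (\<psi> g f))"
proof (intro iffI ballI)
  fix f assume *: "\<forall>f\<in>mfacets_at n \<Omega> (\<phi> g i). P (\<psi> (inv g) f) f" "f \<in> mfacets_at n \<Omega> i"
  then have "P (\<psi> (inv g) (\<psi> g f)) (\<psi> g f)"
    using facet_action_mfacets_at assms by blast
  then show "P f (\<psi> g f)"
    using facet.orbit_sym_aux[OF assms(1) _ refl, of f] *(2) mfacets_at_subset[THEN subsetD] by simp
next
  fix f assume *: "\<forall>f\<in>mfacets_at n \<Omega> i. P f (\<psi> g f)" "f \<in> mfacets_at n \<Omega> (\<phi> g i)"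
  have "\<psi> (inv g) f \<in> mfacets_at n \<Omega> i"
    using facet_action_mfacets_at[OF inv_closed[OF assms(1)] *(2)] assms vertex_inv by simp
  then have "P (\<psi> (inv g) f) (\<psi> g (\<psi> (inv g) f))"
    using * by blast
  moreover have "f \<in> mfacets n \<Omega>"
    using *(2) mfacets_at_subset by blast
  ultimately show "P (\<psi> (inv g) f) f"
    using facet.orbit_sym_aux[of "inv g" f] assms by auto
qed

lemma equivariant_facet_map:
  obtains z where "z \<in> mfacets n \<Omega> \<rightarrow> carrier G"
    "\<And>g f. g \<in> carrier G \<Longrightarrow> f \<in> mfacets n \<Omega> \<Longrightarrow> z (\<psi> g f) = g \<otimes> z f"
  using facet.equivariant_map_exists free unfolding free_complex_action_def by blast

section \<open>Kernel of the vertex action\<close>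

lemma vertex_action_eq_iff:
  assumes "g \<in> carrier G" "h \<in> carrier G"
  shows "\<phi> g = \<phi> h \<longleftrightarrow> (\<forall>i\<le>n. \<phi> g i = \<phi> h i)"
proof
  assume *: "\<forall>i\<le>n. \<phi> g i = \<phi> h i"
  have "\<phi> g \<in> extensional {0..n}" "\<phi> h \<in> extensional {0..n}"
    using vertex.bij_prop0 assms by (auto simp: Bij_def)
  then show "\<phi> g = \<phi> h"
    by (rule extensionalityI) (use * in auto)
qed simp

text \<open>Freeness concerns the copies of facets only, so distinct group elements may move the
  vertices alike. The comparison is with \<open>\<phi> \<one>\<close> because this is the identity
  restricted to \<open>{0..n}\<close>, not the identity on all naturals.\<close>

definition vertex_kernel where "vertex_kernel = {g \<in> carrier G. \<phi> g = \<phi> \<one>}"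

lemma vertex_action_eq_inv:
  assumes "g \<in> carrier G" "h \<in> carrier G" "\<phi> g = \<phi> h"
  shows "\<phi> (inv g) = \<phi> (inv h)"
  using assms vertex.group_hom by (simp add: group_hom.hom_inv)

text \<open>The fibre over \<open>\<phi> g\<close> is a coset of the kernel: right multiplication by
  \<open>inv g\<close> and by \<open>g\<close> are mutually inverse maps between the two.\<close>

lemma card_vertex_fibre:
  assumes "g \<in> carrier G"
  shows "card {h \<in> carrier G. \<phi> h = \<phi> g} = card vertex_kernel"
proof (rule bij_betw_same_card)
  have one: "\<phi> \<one> i = i" if "i \<le> n" for i
    using vertex.id_eq_one that by (metis atLeastAtMost_iff le0 restrict_apply')
  have "h \<otimes> inv g \<in> vertex_kernel" if "h \<in> carrier G" "\<phi> h = \<phi> g" for h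
    using that assms vertex_inv[of "inv g"] one vertex_closed[of "inv g"]
    by (auto simp: vertex_kernel_def vertex_action_eq_iff vertex_mult)
  moreover have "\<phi> (k \<otimes> g) = \<phi> g" if "k \<in> vertex_kernel" for k
    using that assms one vertex_closed by (auto simp: vertex_kernel_def vertex_action_eq_iff vertex_mult)
  ultimately show "bij_betw (\<lambda>h. h \<otimes> inv g) {h \<in> carrier G. \<phi> h = \<phi> g} vertex_kernel"
    using assms
    by (intro bij_betw_byWitness[where f' = "\<lambda>k. k \<otimes> g"])
       (auto simp: m_assoc vertex_kernel_def)
qed

lemma card_vertex_kernel_pos: "card vertex_kernel > 0"
  using finite_G by (auto simp: card_gt_0_iff vertex_kernel_def)

end

subsection \<open>The invariant decomposition\<close>

text \<open>\<open>r\<close> stands for the rescaled summands and \<open>z\<close> for the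
  equivariant map on copies of facets. \<open>enc\<close> numbers the labels, because the ranks
  range over index sets of natural numbers.\<close>

locale sos_construction = free_connected_action n \<Omega> G \<phi> \<psi>
  for n \<Omega> and G :: "('g, 'b) monoid_scheme" (structure) and \<phi> \<psi> +
  fixes m :: nat and r :: "nat \<Rightarrow> mpol" and N :: nat
    and z :: "nat set \<times> nat \<Rightarrow> 'g"
    and enc :: "(nat \<times> (nat \<times> nat \<Rightarrow>\<^sub>0 nat)) \<times> 'g \<Rightarrow> nat"
  assumes r_polys: "j < N \<Longrightarrow> r j \<in> polys n m"
    and z_closed: "f \<in> mfacets n \<Omega> \<Longrightarrow> z f \<in> carrier G"
    and z_equivariant: "g \<in> carrier G \<Longrightarrow> f \<in> mfacets n \<Omega> \<Longrightarrow> z (\<psi> g f) = g \<otimes> z f"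
    and enc_inj: "inj_on enc ((SIGMA j:{..<N}. Poly_Mapping.keys (r j)) \<times> carrier G)"
begin

definition terms where "terms = (SIGMA j:{..<N}. Poly_Mapping.keys (r j))"

text \<open>The coefficient of the term is carried by block \<open>0\<close>.\<close>

definition term_factor :: "nat \<times> (nat \<times> nat \<Rightarrow>\<^sub>0 nat) \<Rightarrow> nat \<Rightarrow> mpol" where
  "term_factor u a = (if a = 0 then const (Poly_Mapping.lookup (r (fst u)) (snd u)) else 1) *
     (\<Prod>v\<in>{v \<in> Poly_Mapping.keys (snd u). fst v = a}. var v ^ Poly_Mapping.lookup (snd u) v)"

definition labelling where
  "labelling F x = (\<lambda>f\<in>F. enc (fst x, snd x \<otimes> z f))"

text \<open>At most one \<open>x\<close> contributes when \<open>i\<close> is a vertex, see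
  \<open>local_poly_eq\<close>. Writing it as a sum gives a value for every \<open>\<beta>\<close>
  without choosing \<open>x\<close>, and turns invariance into a reindexing of the sum.\<close>

definition local_poly where
  "local_poly i k \<beta> = (\<Sum>x\<in>terms \<times> carrier G.
     if k = prod_encode (fst (fst x), \<phi> (snd x) i) \<and>
        (\<forall>f\<in>mfacets_at n \<Omega> i. \<beta> f = enc (fst x, snd x \<otimes> z f))
     then to_block i (term_factor (fst x) (\<phi> (snd x) i)) else 0)"

text \<open>The same set at every vertex, so its invariance under \<open>G\<close> is immediate;
  \<open>prod_encode\<close> makes the indices natural numbers.\<close>

definition vertex_indices :: "nat \<Rightarrow> nat set" where
  "vertex_indices i = prod_encode ` ({..<N} \<times> {0..n})"

definition facet_indices where "facet_indices = enc ` (terms \<times> carrier G)"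

definition orbit_index where "orbit_index j g = (\<lambda>i\<in>{0..n}. prod_encode (j, \<phi> g i))"

text \<open>All pairs giving the same tuple share \<open>j\<close> and have group elements in one
  coset of the kernel. Their summands agree, so the value is a multiple of one permuted
  \<open>r j\<close>.\<close>

definition orbit_family where
  "orbit_family k = (\<Sum>(j, g)\<in>{..<N} \<times> carrier G.
     if k = orbit_index j g then permute_blocks (\<phi> (inv g)) (r j) else 0)"

section \<open>Labels and factors of terms\<close>

lemma finite_terms: "finite (terms \<times> carrier G)"
  using finite_G by (simp add: terms_def)

text \<open>By right cancellation of \<open>z f\<close>, the label at a single copy \<open>f\<close>
  already determines \<open>x\<close>. The rigidity of the labellings rests on this.\<close>

lemma enc_eq_iff:
  assumes "x \<in> terms \<times> carrier G" "y \<in> terms \<times> carrier G" "f \<in> mfacets n \<Omega>"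
  shows "enc (fst x, snd x \<otimes> z f) = enc (fst y, snd y \<otimes> z f) \<longleftrightarrow> x = y"
proof -
  have "enc (fst x, snd x \<otimes> z f) = enc (fst y, snd y \<otimes> z f) \<longleftrightarrow>
      (fst x, snd x \<otimes> z f) = (fst y, snd y \<otimes> z f)"
    by (rule inj_on_eq_iff[OF enc_inj]) (use assms z_closed[of f] in \<open>auto simp: terms_def\<close>)
  then show ?thesis
    using assms z_closed[of f] by (auto simp: prod_eq_iff)
qed

lemma enc_in_facet_indices:
  "x \<in> terms \<times> carrier G \<Longrightarrow> f \<in> mfacets n \<Omega> \<Longrightarrow> enc (fst x, snd x \<otimes> z f) \<in> facet_indices"
  using z_closed[of f] by (auto simp: facet_indices_def)

lemma keys_term:
  assumes "u \<in> terms"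
  shows "Poly_Mapping.keys (snd u) \<subseteq> {0..n} \<times> {1..m}"
proof -
  have "snd u \<in> Poly_Mapping.keys (r (fst u))" "r (fst u) \<in> polys n m"
    using assms r_polys by (auto simp: terms_def)
  then show ?thesis
    unfolding polys_def vars_def by blast
qed

lemma vars_term_factor:
  assumes "u \<in> terms"
  shows "vars (term_factor u a) \<subseteq> {a} \<times> {1..m}"
proof -
  let ?M = "\<Prod>v\<in>{v \<in> Poly_Mapping.keys (snd u). fst v = a}. var v ^ Poly_Mapping.lookup (snd u) v"
  have "vars ?M \<subseteq> (\<Union>v\<in>{v \<in> Poly_Mapping.keys (snd u). fst v = a}. vars (var v))"
    using vars_prod vars_power by fastforce
  also have "\<dots> \<subseteq> {a} \<times> {1..m}"
    using keys_term[OF assms] by auto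
  finally have "vars ?M \<subseteq> {a} \<times> {1..m}" .
  then show ?thesis
    using vars_mult unfolding term_factor_def by (fastforce split: if_splits)
qed

text \<open>The variables of the monomial are grouped by block, and the coefficient enters exactly
  once.\<close>

lemma prod_term_factor:
  assumes "u \<in> terms"
  shows "(\<Prod>a\<in>{0..n}. term_factor u a) =
    const (Poly_Mapping.lookup (r (fst u)) (snd u)) * monom_eval var (snd u)"
proof -
  have "fst ` Poly_Mapping.keys (snd u) \<subseteq> {0..n}"
    using keys_term[OF assms] by fastforce
  then have "(\<Prod>a\<in>{0..n}. \<Prod>v\<in>{v \<in> Poly_Mapping.keys (snd u). fst v = a}.
      var v ^ Poly_Mapping.lookup (snd u) v) = monom_eval var (snd u)"
    unfolding monom_eval_def by (intro prod.group) auto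
  then show ?thesis
    by (simp add: term_factor_def prod.distrib prod.delta)
qed

lemma sum_terms:
  assumes "j < N"
  shows "(\<Sum>t\<in>Poly_Mapping.keys (r j). \<Prod>a\<in>{0..n}. term_factor (j, t) a) = r j"
proof -
  have "(\<Sum>t\<in>Poly_Mapping.keys (r j). \<Prod>a\<in>{0..n}. term_factor (j, t) a) =
      (\<Sum>t\<in>Poly_Mapping.keys (r j). const (Poly_Mapping.lookup (r j) t) * monom_eval var t)"
    using assms by (intro sum.cong refl) (simp add: prod_term_factor terms_def)
  also have "\<dots> = subst var (r j)"
    by (rule subst_superset[symmetric]) auto
  finally show ?thesis
    by (simp add: subst_id)
qed

lemma to_block_to_block: "to_block i (to_block b p) = to_block i p"
  by (simp add: to_block_def subst_subst case_prod_unfold)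

text \<open>The factor for block \<open>\<phi> g i\<close> has variables in that block only, and
  \<open>inv g\<close> sends this block to \<open>i\<close>. On it, moving to block \<open>i\<close>
  and permuting by \<open>inv g\<close> therefore coincide; \<open>\<phi> g\<close> then reindexes
  the product.\<close>

lemma prod_to_block_term_factor:
  assumes "u \<in> terms" "g \<in> carrier G"
  shows "(\<Prod>i\<in>{0..n}. to_block i (term_factor u (\<phi> g i))) =
    permute_blocks (\<phi> (inv g)) (\<Prod>a\<in>{0..n}. term_factor u a)"
proof -
  have "to_block i (term_factor u (\<phi> g i)) = permute_blocks (\<phi> (inv g)) (term_factor u (\<phi> g i))"
    if "i \<in> {0..n}" for i
    unfolding to_block_def permute_blocks_def
    by (rule subst_cong) (use vars_term_factor[OF assms(1), of "\<phi> g i"] vertex_inv assms that in auto)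
  moreover have "bij_betw (\<phi> g) {0..n} {0..n}"
    using vertex.bij_prop0[OF assms(2)] by (simp add: Bij_def)
  ultimately show ?thesis
    using prod.reindex_bij_betw[of "\<phi> g" "{0..n}" "{0..n}" "\<lambda>a. permute_blocks (\<phi> (inv g)) (term_factor u a)"]
    by (simp add: permute_blocks_def subst_prod)
qed

section \<open>Local polynomials and global labellings\<close>

lemma local_poly_block:
  assumes "i \<le> n"
  shows "local_poly i k \<beta> \<in> block_polys m i"
proof -
  have "vars (to_block i (term_factor u a)) \<subseteq> {i} \<times> {1..m}" if "u \<in> terms" for u a
    using vars_subst[of "\<lambda>(b, l). var (i, l)" "term_factor u a"] vars_term_factor[OF that, of a]
    unfolding to_block_def by fastforce
  \<comment> \<open>The condition selecting \<open>x\<close> has no bearing on the variables, so it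
    is abstracted to an arbitrary \<open>P\<close>.\<close>
  then have "(\<Union>x\<in>terms \<times> carrier G. vars (if P x
      then to_block i (term_factor (fst x) (\<phi> (snd x) i)) else 0)) \<subseteq> {i} \<times> {1..m}" for P
    by (intro UN_least) (simp add: mem_Times_iff)
  then show ?thesis
    unfolding local_poly_def block_polys_def mem_Collect_eq by (rule order_trans[OF vars_sum])
qed

text \<open>Some copy contains \<open>i\<close>, and its label admits only the given
  \<open>x\<close>; the sum collapses to one summand.\<close>

lemma local_poly_eq:
  assumes "i \<le> n" "x \<in> terms \<times> carrier G"
    and \<beta>: "\<And>f. f \<in> mfacets_at n \<Omega> i \<Longrightarrow> \<beta> f = enc (fst x, snd x \<otimes> z f)"
  shows "local_poly i k \<beta> = (if k = prod_encode (fst (fst x), \<phi> (snd x) i)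
    then to_block i (term_factor (fst x) (\<phi> (snd x) i)) else 0)"
proof -
  obtain f where f: "f \<in> mfacets_at n \<Omega> i" "f \<in> mfacets n \<Omega>"
    using mfacets_at_nonempty[OF assms(1)] mfacets_at_subset by blast
  have "(\<forall>f\<in>mfacets_at n \<Omega> i. \<beta> f = enc (fst y, snd y \<otimes> z f)) \<longleftrightarrow> y = x"
    if "y \<in> terms \<times> carrier G" for y
    using f(1) \<beta> enc_eq_iff[OF assms(2) that f(2)] by auto
  then have "local_poly i k \<beta> = (\<Sum>y\<in>terms \<times> carrier G. if y = x then
      if k = prod_encode (fst (fst x), \<phi> (snd x) i)
      then to_block i (term_factor (fst x) (\<phi> (snd x) i)) else 0 else 0)"
    unfolding local_poly_def by (intro sum.cong refl) auto
  then show ?thesis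
    using finite_terms assms(2) by (simp add: sum.delta)
qed

lemma local_poly_nonzero:
  assumes "local_poly i k \<beta> \<noteq> 0"
  shows "\<exists>x\<in>terms \<times> carrier G. \<forall>f\<in>mfacets_at n \<Omega> i. \<beta> f = enc (fst x, snd x \<otimes> z f)"
proof -
  obtain x where "x \<in> terms \<times> carrier G" "(if k = prod_encode (fst (fst x), \<phi> (snd x) i) \<and>
        (\<forall>f\<in>mfacets_at n \<Omega> i. \<beta> f = enc (fst x, snd x \<otimes> z f))
     then to_block i (term_factor (fst x) (\<phi> (snd x) i)) else 0) \<noteq> 0"
    using assms unfolding local_poly_def by (rule sum.not_neutral_contains_not_neutral)
  then show ?thesis
    by (intro bexI[of _ x]) (simp_all split: if_splits)
qed

text \<open>Neighbouring vertices share a facet, and one label determines the pair \<open>x\<close>.\<close>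

lemma locally_labelled_imp_labelled:
  assumes \<alpha>: "\<alpha> \<in> mfacets n \<Omega> \<rightarrow>\<^sub>E facet_indices"
    and local: "\<And>i. i \<le> n \<Longrightarrow> \<exists>x\<in>terms \<times> carrier G.
      \<forall>f\<in>mfacets_at n \<Omega> i. \<alpha> f = enc (fst x, snd x \<otimes> z f)"
  shows "\<alpha> \<in> labelling (mfacets n \<Omega>) ` (terms \<times> carrier G)"
proof -
  obtain x where x: "x \<in> terms \<times> carrier G"
      "\<forall>f\<in>mfacets_at n \<Omega> 0. \<alpha> f = enc (fst x, snd x \<otimes> z f)"
    using local[of 0] by blast
  have step: "\<forall>f\<in>mfacets_at n \<Omega> i. \<alpha> f = enc (fst x, snd x \<otimes> z f)"
    if "(0, i) \<in> (neighbours n \<Omega>)\<^sup>*" for i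
    using that
  proof (induction rule: rtrancl_induct)
    case (step i j)
    then obtain F where F: "F \<in> facets n \<Omega>" "i \<in> F" "j \<in> F"
      by (auto simp: neighbours_def)
    then have "j \<le> n"
      by (auto simp: facets_def simplices_def)
    then obtain y where y: "y \<in> terms \<times> carrier G"
        "\<forall>f\<in>mfacets_at n \<Omega> j. \<alpha> f = enc (fst y, snd y \<otimes> z f)"
      using local by blast
    have "(F, 0) \<in> mfacets_at n \<Omega> i" "(F, 0) \<in> mfacets_at n \<Omega> j"
      using F facet_copy by auto
    then have "enc (fst x, snd x \<otimes> z (F, 0)) = enc (fst y, snd y \<otimes> z (F, 0))" "(F, 0) \<in> mfacets n \<Omega>"
      using step.IH y(2) mfacets_at_subset by force+
    then have "x = y"
      using enc_eq_iff x(1) y(1) by blast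
    then show ?case
      using y(2) by simp
  qed (use x in simp)
  \<comment> \<open>The pair \<open>x\<close> found at vertex 0 now serves all vertices, and every
    copy contains one. Outside the copies both functions take the default value.\<close>
  have "\<alpha> = labelling (mfacets n \<Omega>) x"
  proof (rule extensionalityI[of _ "mfacets n \<Omega>"])
    fix f assume f: "f \<in> mfacets n \<Omega>"
    then obtain i where i: "i \<le> n" "f \<in> mfacets_at n \<Omega> i"
      by (rule mfacet_has_vertex)
    then have "(0, i) \<in> (neighbours n \<Omega>)\<^sup>*"
      using connected by (auto simp: connected_complex_def)
    then show "\<alpha> f = labelling (mfacets n \<Omega>) x f"
      using step i f by (simp add: labelling_def)
  qed (use \<alpha> in \<open>auto simp: labelling_def PiE_iff\<close>)
  then show ?thesis
    using x(1) by blast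
qed

lemma inj_labelling: "inj_on (labelling (mfacets n \<Omega>)) (terms \<times> carrier G)"
proof (rule inj_onI)
  fix x y assume *: "x \<in> terms \<times> carrier G" "y \<in> terms \<times> carrier G"
    "labelling (mfacets n \<Omega>) x = labelling (mfacets n \<Omega>) y"
  obtain f where f: "f \<in> mfacets n \<Omega>"
    using mfacets_at_nonempty[of 0] mfacets_at_subset by blast
  then show "x = y"
    using fun_cong[OF *(3), of f] enc_eq_iff[OF *(1,2) f] by (simp add: labelling_def)
qed

section \<open>Orbit tuples and the sum over labellings\<close>

lemma orbit_index_in: "j < N \<Longrightarrow> g \<in> carrier G \<Longrightarrow> orbit_index j g \<in> PiE {0..n} vertex_indices"
  using vertex_closed by (auto simp: orbit_index_def vertex_indices_def)

lemma orbit_index_eq_iff: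
  assumes "g \<in> carrier G" "h \<in> carrier G"
  shows "orbit_index j g = orbit_index l h \<longleftrightarrow> j = l \<and> \<phi> g = \<phi> h"
proof
  assume *: "orbit_index j g = orbit_index l h"
  have "j = l \<and> \<phi> g i = \<phi> h i" if "i \<le> n" for i
    using fun_cong[OF *, of i] that by (simp add: orbit_index_def)
  then show "j = l \<and> \<phi> g = \<phi> h"
    using vertex_action_eq_iff[OF assms] by auto
qed (simp add: orbit_index_def)

lemma eq_orbit_index_iff:
  assumes "k \<in> PiE {0..n} vertex_indices"
  shows "k = orbit_index j g \<longleftrightarrow> (\<forall>i\<in>{0..n}. k i = prod_encode (j, \<phi> g i))"
  using assms by (auto simp: orbit_index_def PiE_iff intro!: extensionalityI[of k "{0..n}"])

text \<open>Around every vertex the labelling forces the same \<open>x\<close>. A single mismatch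
  between \<open>k i\<close> and \<open>x\<close> kills the product, and having no mismatch means
  that \<open>k\<close> is the orbit tuple of \<open>x\<close>.\<close>

lemma prod_local_poly_labelling:
  assumes "k \<in> PiE {0..n} vertex_indices" "x \<in> terms \<times> carrier G"
  shows "(\<Prod>i\<in>{0..n}. local_poly i (k i) (restrict (labelling (mfacets n \<Omega>) x) (mfacets_at n \<Omega> i))) =
    (if k = orbit_index (fst (fst x)) (snd x)
     then permute_blocks (\<phi> (inv (snd x))) (\<Prod>a\<in>{0..n}. term_factor (fst x) a) else 0)"
proof -
  have "local_poly i (k i) (restrict (labelling (mfacets n \<Omega>) x) (mfacets_at n \<Omega> i)) =
      (if k i = prod_encode (fst (fst x), \<phi> (snd x) i)
       then to_block i (term_factor (fst x) (\<phi> (snd x) i)) else 0)" if "i \<in> {0..n}" for i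
    using that assms(2) mfacets_at_subset by (intro local_poly_eq) (auto simp: labelling_def)
  then have "(\<Prod>i\<in>{0..n}. local_poly i (k i) (restrict (labelling (mfacets n \<Omega>) x) (mfacets_at n \<Omega> i))) =
      (\<Prod>i\<in>{0..n}. if k i = prod_encode (fst (fst x), \<phi> (snd x) i)
       then to_block i (term_factor (fst x) (\<phi> (snd x) i)) else 0)"
    by simp
  also have "\<dots> = (if k = orbit_index (fst (fst x)) (snd x)
      then \<Prod>i\<in>{0..n}. to_block i (term_factor (fst x) (\<phi> (snd x) i)) else 0)"
    unfolding eq_orbit_index_iff[OF assms(1)] by (auto intro!: prod_zero)
  finally show ?thesis
    using prod_to_block_term_factor[of "fst x" "snd x"] assms(2) by auto
qed

text \<open>A nonzero product forces consistent labels around each vertex, hence a global labelling.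
  The sum over \<alpha> thus becomes a sum over terms and group elements.\<close>

lemma orbit_family_eq_sum_prod:
  assumes k: "k \<in> PiE {0..n} vertex_indices"
  shows "orbit_family k = (\<Sum>\<alpha>\<in>mfacets n \<Omega> \<rightarrow>\<^sub>E facet_indices.
    \<Prod>i\<in>{0..n}. local_poly i (k i) (restrict \<alpha> (mfacets_at n \<Omega> i)))"
    (is "_ = (\<Sum>\<alpha>\<in>?A. ?P \<alpha>)")
proof -
  have "(\<Sum>\<alpha>\<in>?A. ?P \<alpha>) = (\<Sum>\<alpha>\<in>labelling (mfacets n \<Omega>) ` (terms \<times> carrier G). ?P \<alpha>)"
  proof (rule sum.mono_neutral_right)
    show "finite ?A"
      using finite_mfacets finite_terms by (intro finite_PiE) (auto simp: facet_indices_def)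
    show "labelling (mfacets n \<Omega>) ` (terms \<times> carrier G) \<subseteq> ?A"
      using enc_in_facet_indices by (auto simp: labelling_def)
    show "\<forall>\<alpha>\<in>?A - labelling (mfacets n \<Omega>) ` (terms \<times> carrier G). ?P \<alpha> = 0"
    proof (intro ballI, rule ccontr)
      fix \<alpha> assume \<alpha>: "\<alpha> \<in> ?A - labelling (mfacets n \<Omega>) ` (terms \<times> carrier G)" "?P \<alpha> \<noteq> 0"
      have "\<exists>x\<in>terms \<times> carrier G. \<forall>f\<in>mfacets_at n \<Omega> i. \<alpha> f = enc (fst x, snd x \<otimes> z f)"
        if "i \<le> n" for i
      proof -
        have "local_poly i (k i) (restrict \<alpha> (mfacets_at n \<Omega> i)) \<noteq> 0"
        proof
          assume "local_poly i (k i) (restrict \<alpha> (mfacets_at n \<Omega> i)) = 0"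
          then have "?P \<alpha> = 0"
            using that by (intro prod_zero bexI[of _ i]) auto
          then show False
            using \<alpha>(2) by contradiction
        qed
        then show ?thesis
          using local_poly_nonzero by fastforce
      qed
      then show False
        using locally_labelled_imp_labelled \<alpha>(1) by blast
    qed
  qed
  also have "\<dots> = (\<Sum>x\<in>terms \<times> carrier G. ?P (labelling (mfacets n \<Omega>) x))"
    by (simp add: sum.reindex[OF inj_labelling])
  also have "\<dots> = (\<Sum>x\<in>terms \<times> carrier G. if k = orbit_index (fst (fst x)) (snd x)
     then permute_blocks (\<phi> (inv (snd x))) (\<Prod>a\<in>{0..n}. term_factor (fst x) a) else 0)"
    by (rule sum.cong[OF refl]) (rule prod_local_poly_labelling[OF k])
  also have "\<dots> = (\<Sum>u\<in>terms. \<Sum>g\<in>carrier G. if k = orbit_index (fst u) g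
     then permute_blocks (\<phi> (inv g)) (\<Prod>a\<in>{0..n}. term_factor u a) else 0)"
    by (simp only: sum.cartesian_product split_def)
  also have "\<dots> = (\<Sum>j<N. \<Sum>t\<in>Poly_Mapping.keys (r j). \<Sum>g\<in>carrier G. if k = orbit_index j g
     then permute_blocks (\<phi> (inv g)) (\<Prod>a\<in>{0..n}. term_factor (j, t) a) else 0)"
    unfolding terms_def
    by (subst sum.Sigma[of "{..<N}" "\<lambda>j. Poly_Mapping.keys (r j)"]) (auto intro!: sum.cong)
  also have "\<dots> = (\<Sum>j<N. \<Sum>g\<in>carrier G. \<Sum>t\<in>Poly_Mapping.keys (r j). if k = orbit_index j g
     then permute_blocks (\<phi> (inv g)) (\<Prod>a\<in>{0..n}. term_factor (j, t) a) else 0)"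
    by (intro sum.cong refl) (rule sum.swap)
  also have "\<dots> = (\<Sum>j<N. \<Sum>g\<in>carrier G. if k = orbit_index j g
     then permute_blocks (\<phi> (inv g)) (r j) else 0)"
    \<comment> \<open>The condition on \<open>k\<close> does not involve \<open>t\<close>, so the
      sum over monomials reassembles \<open>r j\<close> inside the substitution.\<close>
    by (intro sum.cong refl) (auto simp: sum_terms permute_blocks_def simp flip: subst_sum)
  also have "\<dots> = orbit_family k"
    by (simp add: orbit_family_def sum.cartesian_product)
  finally show ?thesis ..
qed

text \<open>Replacing \<open>(u, h)\<close> by \<open>(u, h \<otimes> g)\<close> permutes the
  summands. It matches the vertices because h(gi) = (hg)i, and the labels because h z(gf) = hg z(f)
  by equivariance of \<open>z\<close>.\<close>

lemma local_poly_equivariant: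
  assumes "i \<le> n" "g \<in> carrier G"
  shows "local_poly i k \<beta> = to_block i (local_poly (\<phi> g i) k (translate n \<Omega> G \<phi> \<psi> g i \<beta>))"
proof -
  let ?\<tau> = "\<lambda>x. (fst x, snd x \<otimes> g)"
  have "to_block i (local_poly (\<phi> g i) k (translate n \<Omega> G \<phi> \<psi> g i \<beta>)) =
     (\<Sum>x\<in>terms \<times> carrier G. if k = prod_encode (fst (fst x), \<phi> (snd x) (\<phi> g i)) \<and>
        (\<forall>f\<in>mfacets_at n \<Omega> (\<phi> g i). \<beta> (\<psi> (inv g) f) = enc (fst x, snd x \<otimes> z f))
      then to_block i (term_factor (fst x) (\<phi> (snd x) (\<phi> g i))) else 0)"
    \<comment> \<open>Of two successive block moves only the last one counts, so the detour through
      block \<open>\<phi> g i\<close> disappears.\<close>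
    unfolding local_poly_def to_block_def[of i "sum _ _"] subst_sum to_block_def[symmetric]
    by (intro sum.cong refl) (auto simp: translate_def to_block_to_block, auto simp: to_block_def)
  also have "\<dots> = (\<Sum>x\<in>terms \<times> carrier G.
     if k = prod_encode (fst (fst (?\<tau> x)), \<phi> (snd (?\<tau> x)) i) \<and>
        (\<forall>f\<in>mfacets_at n \<Omega> i. \<beta> f = enc (fst (?\<tau> x), snd (?\<tau> x) \<otimes> z f))
     then to_block i (term_factor (fst (?\<tau> x)) (\<phi> (snd (?\<tau> x)) i)) else 0)"
  proof (rule sum.cong[OF refl])
    fix x assume x: "x \<in> terms \<times> carrier G"
    have "(\<forall>f\<in>mfacets_at n \<Omega> (\<phi> g i). \<beta> (\<psi> (inv g) f) = enc (fst x, snd x \<otimes> z f)) \<longleftrightarrow>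
        (\<forall>f\<in>mfacets_at n \<Omega> i. \<beta> f = enc (fst x, snd x \<otimes> z (\<psi> g f)))"
      by (rule ball_translated_mfacets_at[OF assms(2,1)])
    also have "\<dots> \<longleftrightarrow> (\<forall>f\<in>mfacets_at n \<Omega> i. \<beta> f = enc (fst x, snd x \<otimes> g \<otimes> z f))"
    proof (rule ball_cong[OF refl])
      fix f assume "f \<in> mfacets_at n \<Omega> i"
      then have "f \<in> mfacets n \<Omega>"
        using mfacets_at_subset by blast
      then show "\<beta> f = enc (fst x, snd x \<otimes> z (\<psi> g f)) \<longleftrightarrow> \<beta> f = enc (fst x, snd x \<otimes> g \<otimes> z f)"
        using x assms z_closed[of f] by (auto simp: z_equivariant m_assoc)
    qed
    finally show "(if k = prod_encode (fst (fst x), \<phi> (snd x) (\<phi> g i)) \<and>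
        (\<forall>f\<in>mfacets_at n \<Omega> (\<phi> g i). \<beta> (\<psi> (inv g) f) = enc (fst x, snd x \<otimes> z f))
      then to_block i (term_factor (fst x) (\<phi> (snd x) (\<phi> g i))) else 0) =
      (if k = prod_encode (fst (fst (?\<tau> x)), \<phi> (snd (?\<tau> x)) i) \<and>
        (\<forall>f\<in>mfacets_at n \<Omega> i. \<beta> f = enc (fst (?\<tau> x), snd (?\<tau> x) \<otimes> z f))
     then to_block i (term_factor (fst (?\<tau> x)) (\<phi> (snd (?\<tau> x)) i)) else 0)"
      using x assms by (auto simp: vertex_mult)
  qed
  also have "\<dots> = local_poly i k \<beta>"
    unfolding local_poly_def
  proof (rule sum.reindex_bij_betw)
    show "bij_betw ?\<tau> (terms \<times> carrier G) (terms \<times> carrier G)"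
      using assms(2)
      by (intro bij_betw_byWitness[where f' = "\<lambda>x. (fst x, snd x \<otimes> inv g)"]) (auto simp: m_assoc)
  qed
  finally show ?thesis ..
qed

section \<open>The squares add up to a multiple of the original sum\<close>

lemma orbit_family_orbit_index:
  assumes "j < N" "g \<in> carrier G"
  shows "orbit_family (orbit_index j g) =
    of_nat (card vertex_kernel) * permute_blocks (\<phi> (inv g)) (r j)"
proof -
  \<comment> \<open>Only elements \<open>h\<close> acting on the vertices like \<open>g\<close>
    contribute. Their inverses act alike too, so each contributes the same polynomial, and the fibre
    is counted by \<open>card_vertex_fibre\<close>.\<close>
  have "orbit_family (orbit_index j g) = (\<Sum>l<N. \<Sum>h\<in>carrier G.
      if j = l then if \<phi> h = \<phi> g then permute_blocks (\<phi> (inv g)) (r j) else 0 else 0)"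
    unfolding orbit_family_def sum.cartesian_product[symmetric]
  proof (intro sum.cong refl)
    fix l h assume "h \<in> carrier G"
    then show "(if orbit_index j g = orbit_index l h then permute_blocks (\<phi> (inv h)) (r l) else 0) =
      (if j = l then if \<phi> h = \<phi> g then permute_blocks (\<phi> (inv g)) (r j) else 0 else 0)"
      using orbit_index_eq_iff[OF assms(2)] vertex_action_eq_inv[OF assms(2)] by auto
  qed
  also have "\<dots> = (\<Sum>h\<in>carrier G. if \<phi> h = \<phi> g then permute_blocks (\<phi> (inv g)) (r j) else 0)"
    using assms(1) by (subst sum.swap) (simp add: sum.delta')
  also have "\<dots> = of_nat (card {h \<in> carrier G. \<phi> h = \<phi> g}) * permute_blocks (\<phi> (inv g)) (r j)"
    using finite_G by (simp flip: sum.inter_filter)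
  finally show ?thesis
    using assms(2) by (simp add: card_vertex_fibre)
qed

text \<open>Expanding one factor of each square and exchanging the sums leaves one tuple per pair
  \<open>(j, g)\<close>, where the other factor supplies the kernel size. Summing over
  \<open>j\<close> first, invariance makes all group elements contribute equally.\<close>

lemma sum_orbit_family_squares:
  assumes inv: "\<And>g. g \<in> carrier G \<Longrightarrow> permute_blocks (\<phi> g) (\<Sum>j<N. r j ^ 2) = (\<Sum>j<N. r j ^ 2)"
  shows "(\<Sum>k\<in>PiE {0..n} vertex_indices. orbit_family k ^ 2) =
    of_nat (card vertex_kernel * card (carrier G)) * (\<Sum>j<N. r j ^ 2)"
proof -
  let ?R = "\<lambda>x. permute_blocks (\<phi> (inv (snd x))) (r (fst x))"
  let ?K = "PiE {0..n} vertex_indices" and ?X = "{..<N} \<times> carrier G"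
  have fin: "finite ?K"
    by (intro finite_PiE) (auto simp: vertex_indices_def)
  have "(\<Sum>k\<in>?K. orbit_family k ^ 2) =
      (\<Sum>k\<in>?K. \<Sum>x\<in>?X. if k = orbit_index (fst x) (snd x) then orbit_family k * ?R x else 0)"
  proof (rule sum.cong[OF refl])
    fix k
    have "orbit_family k ^ 2 = orbit_family k * (\<Sum>x\<in>?X. if k = orbit_index (fst x) (snd x) then ?R x else 0)"
      \<comment> \<open>Only the second factor is expanded; the first stays intact until its tuple
        is known to be an orbit tuple.\<close>
      unfolding power2_eq_square by (subst (2) orbit_family_def) (simp add: split_def)
    also have "\<dots> = (\<Sum>x\<in>?X. if k = orbit_index (fst x) (snd x) then orbit_family k * ?R x else 0)"
      unfolding sum_distrib_left by (rule sum.cong) auto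
    finally show "orbit_family k ^ 2 =
      (\<Sum>x\<in>?X. if k = orbit_index (fst x) (snd x) then orbit_family k * ?R x else 0)" .
  qed
  also have "\<dots> = (\<Sum>x\<in>?X. \<Sum>k\<in>?K. if k = orbit_index (fst x) (snd x) then orbit_family k * ?R x else 0)"
    by (rule sum.swap)
  also have "\<dots> = (\<Sum>x\<in>?X. of_nat (card vertex_kernel) * ?R x ^ 2)"
  proof (rule sum.cong[OF refl])
    fix x assume x: "x \<in> ?X"
    then have "orbit_index (fst x) (snd x) \<in> ?K"
      by (intro orbit_index_in) auto
    then show "(\<Sum>k\<in>?K. if k = orbit_index (fst x) (snd x) then orbit_family k * ?R x else 0) =
        of_nat (card vertex_kernel) * ?R x ^ 2"
      using fin x by (simp add: sum.delta orbit_family_orbit_index power2_eq_square mem_Times_iff)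
  qed
  also have "\<dots> = of_nat (card vertex_kernel) *
      (\<Sum>g\<in>carrier G. permute_blocks (\<phi> (inv g)) (\<Sum>j<N. r j ^ 2))"
    by (simp add: sum_distrib_left permute_blocks_def subst_sum subst_power sum.cartesian_product'
        sum.swap[of _ "carrier G"])
  also have "\<dots> = of_nat (card vertex_kernel * card (carrier G)) * (\<Sum>j<N. r j ^ 2)"
    using inv by (simp add: mult.assoc)
  finally show ?thesis .
qed

lemma permute_blocks_polys:
  assumes "g \<in> carrier G" "q \<in> polys n m"
  shows "permute_blocks (\<phi> g) q \<in> polys n m"
proof -
  have "vars (permute_blocks (\<phi> g) q) \<subseteq> (\<Union>v\<in>vars q. vars (case v of (i, l) \<Rightarrow> var (\<phi> g i, l)))"
    unfolding permute_blocks_def by (rule vars_subst)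
  also have "\<dots> \<subseteq> {0..n} \<times> {1..m}"
    using assms vertex_closed[OF assms(1)] by (intro UN_least) (auto simp: polys_def split_def)
  finally show ?thesis
    by (simp add: polys_def)
qed

lemma orbit_family_polys: "orbit_family k \<in> polys n m"
proof -
  have "vars (if k = orbit_index j g then permute_blocks (\<phi> (inv g)) (r j) else 0) \<subseteq> {0..n} \<times> {1..m}"
    if "j < N" "g \<in> carrier G" for j g
    using permute_blocks_polys[of "inv g" "r j"] r_polys that by (auto simp: polys_def)
  then have "(\<Union>x\<in>{..<N} \<times> carrier G. vars (case x of (j, g) \<Rightarrow>
      if k = orbit_index j g then permute_blocks (\<phi> (inv g)) (r j) else 0)) \<subseteq> {0..n} \<times> {1..m}"
    by (intro UN_least) (simp add: split_def mem_Times_iff)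
  then show ?thesis
    unfolding orbit_family_def polys_def mem_Collect_eq by (rule order_trans[OF vars_sum])
qed

lemma og_decomposition_orbit_family:
  "og_decomposition n m \<Omega> G \<phi> \<psi> vertex_indices orbit_family facet_indices local_poly"
  unfolding og_decomposition_def
  using finite_terms local_poly_block local_poly_equivariant orbit_family_eq_sum_prod
  by (auto simp: facet_indices_def)

lemma sos_family_orbit_family:
  assumes "\<And>g. g \<in> carrier G \<Longrightarrow> permute_blocks (\<phi> g) (\<Sum>j<N. r j ^ 2) = (\<Sum>j<N. r j ^ 2)"
    and "p = of_nat (card vertex_kernel * card (carrier G)) * (\<Sum>j<N. r j ^ 2)"
  shows "sos_family n m G \<phi> p vertex_indices orbit_family"
  unfolding sos_family_def index_family_def
  using orbit_family_polys sum_orbit_family_squares[OF assms(1)] assms(2)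
  by (auto simp: vertex_indices_def)

end

section \<open>Finiteness of the rank and assembly\<close>

lemma sos_og_rank_finite:
  fixes S :: "nat \<Rightarrow> nat set" and I :: "nat set"
  assumes "sos_og_decomposition n m \<Omega> G \<phi> \<psi> p S q I Q"
  shows "sos_og_rank n m \<Omega> G \<phi> \<psi> p < \<infinity>"
proof -
  have "sos_og_rank n m \<Omega> G \<phi> \<psi> p \<le> og_rank n m \<Omega> G \<phi> \<psi> S q"
    unfolding sos_og_rank_def by (rule Inf_lower) (use assms in \<open>auto simp: sos_og_decomposition_def\<close>)
  also have "\<dots> \<le> enat (card I)"
    unfolding og_rank_def by (rule Inf_lower) (use assms in \<open>auto simp: sos_og_decomposition_def\<close>)
  finally show ?thesis
    by (rule order_le_less_trans) simp
qed

theorem corollary34: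
  fixes n m :: nat
    and \<Omega> :: "nat set \<Rightarrow> nat"
    and G :: "('g, 'b) monoid_scheme"
    and \<phi> :: "'g \<Rightarrow> nat \<Rightarrow> nat"
    and \<psi> :: "'g \<Rightarrow> nat set \<times> nat \<Rightarrow> nat set \<times> nat"
    and p :: mpol
  assumes "weighted_complex n \<Omega>"
    and "connected_complex n \<Omega>"
    and "free_complex_action n \<Omega> G \<phi> \<psi>"
    and "p \<in> polys n m"
    and "is_sos n m p"
    and "invariant_poly G \<phi> p"
  shows "(\<exists>(S :: nat \<Rightarrow> nat set) q (I :: nat set) Q. sos_og_decomposition n m \<Omega> G \<phi> \<psi> p S q I Q)
    \<and> sos_og_rank n m \<Omega> G \<phi> \<psi> p < \<infinity>"
proof -
  interpret free_connected_action n \<Omega> G \<phi> \<psi>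
    by unfold_locales (use assms in auto)
  obtain z where z: "z \<in> mfacets n \<Omega> \<rightarrow> carrier G"
      "\<And>g f. g \<in> carrier G \<Longrightarrow> f \<in> mfacets n \<Omega> \<Longrightarrow> z (\<psi> g f) = g \<otimes>\<^bsub>G\<^esub> z f"
    by (rule equivariant_facet_map) blast
  obtain ps where ps: "set ps \<subseteq> polys n m" "p = sum_list (map (\<lambda>q. q ^ 2) ps)"
    using assms(5) by (auto simp: is_sos_def)
  \<comment> \<open>This is the factor by which \<open>sum_orbit_family_squares\<close> multiplies
    the sum of squares; scaling each summand by \<open>1 / sqrt c\<close> cancels it.\<close>
  define c where "c = real (card vertex_kernel * card (carrier G))"
  have "c > 0"
    using card_vertex_kernel_pos finite_G unfolding c_def of_nat_0_less_iff
    by (auto simp: card_gt_0_iff)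
  define d where "d = 1 / sqrt c"
  define r where "r j = const d * ps ! j" for j
  have r_polys: "r j \<in> polys n m" if "j < length ps" for j
  proof -
    have "vars (ps ! j) \<subseteq> {0..n} \<times> {1..m}"
      using ps(1) nth_mem[OF that] by (auto simp: polys_def)
    then show ?thesis
      using vars_mult[of "const d" "ps ! j"] by (auto simp: r_def polys_def)
  qed
  have "(\<Sum>j<length ps. r j ^ 2) = const (d * d) * p"
    by (simp add: r_def ps(2) sum_list_sum_nth atLeast0LessThan sum_distrib_left const_mult
        power2_eq_square mult_ac)
  also have "d * d = 1 / c"
    using \<open>c > 0\<close> by (simp add: d_def)
  finally have sum_r: "(\<Sum>j<length ps. r j ^ 2) = const (1 / c) * p" .
  obtain enc :: "(nat \<times> (nat \<times> nat \<Rightarrow>\<^sub>0 nat)) \<times> 'g \<Rightarrow> nat"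
    where enc: "inj_on enc ((SIGMA j:{..<length ps}. Poly_Mapping.keys (r j)) \<times> carrier G)"
    using finite_imp_inj_to_nat_seg[of "(SIGMA j:{..<length ps}. Poly_Mapping.keys (r j)) \<times> carrier G"]
      finite_G by auto
  interpret sos_construction n \<Omega> G \<phi> \<psi> m r "length ps" z enc
    by unfold_locales (use r_polys z enc in auto)
  have "sos_family n m G \<phi> p vertex_indices orbit_family"
  proof (rule sos_family_orbit_family)
    show "permute_blocks (\<phi> g) (\<Sum>j<length ps. r j ^ 2) = (\<Sum>j<length ps. r j ^ 2)"
      if "g \<in> carrier G" for g
      using assms(6) that unfolding sum_r by (simp add: permute_blocks_def subst_mult invariant_poly_def)
    \<comment> \<open>The natural number is rewritten as a constant polynomial so that it cancels
      against \<open>const (1 / c)\<close>.\<close>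
    have "of_nat (card vertex_kernel * card (carrier G)) = const c"
      by (simp add: c_def const_def flip: single_of_nat)
    then have "of_nat (card vertex_kernel * card (carrier G)) * (const (1 / c) * p) = p"
      using \<open>c > 0\<close> by (simp flip: mult.assoc const_mult)
    then show "p = of_nat (card vertex_kernel * card (carrier G)) * (\<Sum>j<length ps. r j ^ 2)"
      unfolding sum_r by simp
  qed
  then have "sos_og_decomposition n m \<Omega> G \<phi> \<psi> p vertex_indices orbit_family facet_indices local_poly"
    using og_decomposition_orbit_family by (simp add: sos_og_decomposition_def)
  then show ?thesis
    using sos_og_rank_finite by blast
qed

end
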